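(* Let $(X,*,0)$ be a BCK-algebra or a BCI-algebra and let $\|\cdot\|_f : X\times(0,\infty)\to[0,1]$ be a fuzzy BCK/BCI-norm on $X$. Then for every integer $n\ge3$, every finite sequence $x_1,x_2,\dots,x_n$ in $X$ and all $t_1,t_2,\dots,t_{n-1}\in(0,\infty)$, $$\|(x_1*x_n,\;t_1+t_2+\cdots+t_{n-1})\|_f\ge\min\{\|(x_1*x_2,t_1)\|_f,\|(x_2*x_3,t_2)\|_f,\dots,\|(x_{n-1}*x_n,t_{n-1})\|_f\}.$$
   Context: A BCI-algebra is a set $X$ with a binary operation $*$ and a distinguished element $0$ such that for all $a,b,c\in X$: (I1) $((a*b)*(a*c))*(c*b)=0$; (I2) $(a*(a*b))*b=0$; (I3) $a*a=0$; (I4) $a*b=0$ and $b*a=0$ imply $a=b$. A BCK-algebra is a BCI-algebra that also satisfies (K): $0*a=0$ for all $a\in X$. For a BCK-algebra or BCI-algebra $(X,*,0)$, a fuzzy BCK/BCI-norm on $X$ is a mapping $\|\cdot\|_f : X\times(0,\infty)\to[0,1]$, with values written $\|(x,t)\|_f$, satisfying for all $x,y,z\in X$ and $s,t\in(0,\infty)$: (FN1) $\|(x,t)\|_f=1$ if and only if $x=0$; (FN2) if $t\ge s$ then $\|(x,t)\|_f\ge\|(x,s)\|_f$; (FN3) $\lim_{t\to\infty}\|(x,t)\|_f=1$; (FN4) $\|(x*z,s+t)\|_f\ge\min\{\|(x*y,s)\|_f,\|(y*z,t)\|_f\}$. *)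

theory Defs
  imports Complex_Main "HOL-Library.FuncSet"
begin

locale bci_algebra =
  fixes X :: "'a set"
    and star :: "'a \<Rightarrow> 'a \<Rightarrow> 'a"
    and zero :: 'a
  assumes star_closed: "a \<in> X \<Longrightarrow> b \<in> X \<Longrightarrow> star a b \<in> X"
    and zero_closed: "zero \<in> X"
    and I1: "a \<in> X \<Longrightarrow> b \<in> X \<Longrightarrow> c \<in> X \<Longrightarrow>
      star (star (star a b) (star a c)) (star c b) = zero"
    and I2: "a \<in> X \<Longrightarrow> b \<in> X \<Longrightarrow> star (star a (star a b)) b = zero"
    and I3: "a \<in> X \<Longrightarrow> star a a = zero"
    and I4: "a \<in> X \<Longrightarrow> b \<in> X \<Longrightarrow> star a b = zero \<Longrightarrow> star b a = zero \<Longrightarrow> a = b"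

locale bck_algebra = bci_algebra +
  assumes K: "a \<in> X \<Longrightarrow> star zero a = zero"

locale fuzzy_bck_bci_norm =
  fixes X :: "'a set"
    and star :: "'a \<Rightarrow> 'a \<Rightarrow> 'a"
    and zero :: 'a
    and N :: "'a \<times> real \<Rightarrow> real"
  assumes algebra: "bck_algebra X star zero \<or> bci_algebra X star zero"
    and range: "N \<in> X \<times> {0<..} \<rightarrow> {0..1}"
    and FN1: "x \<in> X \<Longrightarrow> t > 0 \<Longrightarrow> N (x, t) = 1 \<longleftrightarrow> x = zero"
    and FN2: "x \<in> X \<Longrightarrow> s > 0 \<Longrightarrow> t > 0 \<Longrightarrow> t \<ge> s \<Longrightarrow> N (x, t) \<ge> N (x, s)"
    and FN3: "x \<in> X \<Longrightarrow> ((\<lambda>t. N (x, t)) \<longlongrightarrow> 1) at_top"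
    and FN4: "x \<in> X \<Longrightarrow> y \<in> X \<Longrightarrow> z \<in> X \<Longrightarrow> s > 0 \<Longrightarrow> t > 0 \<Longrightarrow>
      N (star x z, s + t) \<ge> min (N (star x y, s)) (N (star y z, t))"

end

theory Submission
  imports Defs
begin

text \<open>\<open>FN4\<close> is a triangle inequality with \<open>min\<close> in place of
  addition, and it iterates along a chain. Induct on the number \<open>m\<close> of links: the first
  \<open>m\<close> links are bounded by the induction hypothesis, and \<open>FN4\<close> through the
  intermediate point \<open>x (Suc m)\<close> attaches the last one. Starting at
  \<open>m = 1\<close> keeps \<open>Min\<close> on a nonempty set and the total time
  positive.\<close>

lemma (in fuzzy_bck_bci_norm) norm_chain_ge_Min:
  assumes "m \<ge> 1"
    and "\<And>i. i \<in> {1..Suc m} \<Longrightarrow> x i \<in> X"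
    and "\<And>i. i \<in> {1..m} \<Longrightarrow> t i > 0"
  shows "N (star (x 1) (x (Suc m)), \<Sum>i = 1..m. t i)
    \<ge> Min ((\<lambda>i. N (star (x i) (x (i + 1)), t i)) ` {1..m})"
  using assms
proof (induction m rule: nat_induct_at_least)
  case base
  then show ?case by simp
next
  case (Suc m)
  \<comment> \<open>The partial sum serves below as the first time parameter of \<open>FN4\<close>,
    which must be positive.\<close>
  have "(\<Sum>i = 1..m. t i) > 0"
    using Suc.hyps Suc.prems by (intro sum_pos) auto
  let ?f = "\<lambda>i. N (star (x i) (x (i + 1)), t i)"
  have "Min (?f ` {1..Suc m}) = min (?f (Suc m)) (Min (?f ` {1..m}))"
    using Suc.hyps by (simp add: atLeastAtMostSuc_conv)
  \<comment> \<open>The induction hypothesis replaces the minimum over the first \<open>m\<close>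
    links by the norm of their composite.\<close>
  also have "\<dots> \<le> min (N (star (x 1) (x (Suc m)), \<Sum>i = 1..m. t i)) (?f (Suc m))"
    using Suc.IH Suc.prems by (simp add: min.coboundedI2)
  also have "\<dots> \<le> N (star (x 1) (x (Suc (Suc m))), (\<Sum>i = 1..m. t i) + t (Suc m))"
    using FN4[of "x 1" "x (Suc m)" "x (Suc (Suc m))" "\<Sum>i = 1..m. t i" "t (Suc m)"]
      \<open>(\<Sum>i = 1..m. t i) > 0\<close> Suc.prems by simp
  finally show ?case by simp
qed

theorem proposition3p11:
  fixes X :: "'a set"
    and star :: "'a \<Rightarrow> 'a \<Rightarrow> 'a"
    and zero :: 'a
    and N :: "'a \<times> real \<Rightarrow> real"
    and n :: nat
    and x :: "nat \<Rightarrow> 'a"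
    and t :: "nat \<Rightarrow> real"
  assumes "bck_algebra X star zero \<or> bci_algebra X star zero"
    and "fuzzy_bck_bci_norm X star zero N"
    and "n \<ge> 3"
    and "\<And>i. i \<in> {1..n} \<Longrightarrow> x i \<in> X"
    and "\<And>i. i \<in> {1..n - 1} \<Longrightarrow> t i > 0"
  shows "N (star (x 1) (x n), \<Sum>i = 1..n - 1. t i)
    \<ge> Min ((\<lambda>i. N (star (x i) (x (i + 1)), t i)) ` {1..n - 1})"
  \<comment> \<open>A chain of \<open>n\<close> points has \<open>n - 1\<close> links;
    \<open>n \<ge> 3\<close> makes the truncated subtraction harmless, so
    \<open>Suc (n - 1) = n\<close>.\<close>
  using fuzzy_bck_bci_norm.norm_chain_ge_Min[OF assms(2), of "n - 1" x t] assms(3-5) by simp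

end
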